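(* Let $v$ be a prime power, and let $q\geq 2$ and $s\geq 3$ be integers. The following bounds hold: (1) $K_{vq}^{\mathcal{R}}(3,s,2s-1)\leq v^{s+1}\cdot \left[q^{s+1}-q^{s-1}(q-1)\right]$. (2) $K_{vq}^{\mathcal{R}}(2,s,s)\leq v^s \cdot \left[q^{s}-q^{s-2}(q-1)\right]$.
   Context: NRT poset: for positive integers $m,s$, the NRT poset $[m\cdot s]$ is the set $\{1,\ldots,ms\}$ partitioned into $m$ blocks $B_i=\{is+1,\ldots,(i+1)s\}$, $i=0,\ldots,m-1$, where each block is a chain $is+1\preceq is+2\preceq\cdots\preceq (i+1)s$ and elements of different blocks are incomparable. An ideal is a subset $I$ such that $b\in I$ and $a\preceq b$ imply $a\in I$; $\langle A\rangle$ denotes the smallest ideal containing $A$. NRT distance: for $x,y\in\mathbb{Z}_q^{ms}$, $d_{\mathcal{R}}(x,y)=|\langle\{i: x_i\neq y_i\}\rangle|$, the ideal being taken in $[m\cdot s]$. Covering codes: a subset $C\subseteq \mathbb{Z}_q^{ms}$ is an $R$-covering of the NRT space $\mathbb{Z}_q^{ms}$ if for every $x\in\mathbb{Z}_q^{ms}$ there is $c\in C$ with $d_{\mathcal{R}}(x,c)\leq R$. $K_q^{\mathcal{R}}(m,s,R)$ is the smallest cardinality of an $R$-covering of the NRT space $\mathbb{Z}_q^{ms}$ (and $K_{vq}^{\mathcal{R}}$ is the same with alphabet $\mathbb{Z}_{vq}$). *)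

theory Defs
  imports "HOL-Number_Theory.Number_Theory" "HOL-Library.FuncSet"
begin

definition nrt_ground :: "nat \<Rightarrow> nat \<Rightarrow> nat set" where
  "nrt_ground m s = {1..m * s}"

definition nrt_block :: "nat \<Rightarrow> nat \<Rightarrow> nat set" where
  "nrt_block s i = {i * s + 1..(i + 1) * s}"

definition nrt_le :: "nat \<Rightarrow> nat \<Rightarrow> nat \<Rightarrow> nat \<Rightarrow> bool" where
  "nrt_le m s a b \<longleftrightarrow> (\<exists>i<m. a \<in> nrt_block s i \<and> b \<in> nrt_block s i \<and> a \<le> b)"

definition nrt_ideal :: "nat \<Rightarrow> nat \<Rightarrow> nat set \<Rightarrow> bool" where
  "nrt_ideal m s I \<longleftrightarrow>
     I \<subseteq> nrt_ground m s \<and> (\<forall>a b. b \<in> I \<longrightarrow> nrt_le m s a b \<longrightarrow> a \<in> I)"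

(* Meant for A contained in nrt_ground m s; the ground set is then itself an ideal containing A,
   so the intersection is over a nonempty family. *)
definition nrt_ideal_hull :: "nat \<Rightarrow> nat \<Rightarrow> nat set \<Rightarrow> nat set" where
  "nrt_ideal_hull m s A = \<Inter>{I. nrt_ideal m s I \<and> A \<subseteq> I}"

(* Words are functions on the coordinate set {1..m * s}, made extensional (undefined elsewhere) so
   that equality of words is coordinatewise equality. The alphabet Z_q is the carrier {0..q - 1} of
   the library's residue ring. *)
definition nrt_space :: "nat \<Rightarrow> nat \<Rightarrow> nat \<Rightarrow> (nat \<Rightarrow> int) set" where
  "nrt_space q m s = nrt_ground m s \<rightarrow>\<^sub>E carrier (residue_ring (int q))"

definition nrt_dist :: "nat \<Rightarrow> nat \<Rightarrow> (nat \<Rightarrow> int) \<Rightarrow> (nat \<Rightarrow> int) \<Rightarrow> nat" where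
  "nrt_dist m s x y = card (nrt_ideal_hull m s {i \<in> nrt_ground m s. x i \<noteq> y i})"

definition nrt_covering :: "nat \<Rightarrow> nat \<Rightarrow> nat \<Rightarrow> nat \<Rightarrow> (nat \<Rightarrow> int) set \<Rightarrow> bool" where
  "nrt_covering q m s R C \<longleftrightarrow>
     C \<subseteq> nrt_space q m s \<and> (\<forall>x \<in> nrt_space q m s. \<exists>c \<in> C. nrt_dist m s x c \<le> R)"

(* For q > 0 the space is finite and covers itself, so the minimum is attained and card is the
   true cardinality of every covering. *)
definition nrt_K :: "nat \<Rightarrow> nat \<Rightarrow> nat \<Rightarrow> nat \<Rightarrow> nat" where
  "nrt_K q m s R = (LEAST n. \<exists>C. nrt_covering q m s R C \<and> card C = n)"

end

(* Fix a set S of v symbols of an alphabet with n letters and look at the top symbol of the first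
   and of the last block of a word. If neither lies in S, it is enough to match the (almost whole)
   first block and the top symbol of the last one. The words with a top symbol in S are
   covered more economically: a codeword that repeats the same block, with top symbol in S, as first
   and as last block serves the words whose first block it is and those whose last block it is.
   For n = v * q the sizes of the two parts of the code add up to the claimed bounds. *)
theory Submission
  imports Defs
begin

section \<open>Ideals and upper bounds on the NRT distance\<close>

text \<open>Comparable elements share a block, so closing downwards happens inside one chain, where
  initial segments are closed. The bound by \<open>s\<close> keeps each segment in its own
  block.\<close>

lemma nrt_ideal_Union_initial:
  assumes "\<And>i. i < m \<Longrightarrow> r i \<le> s"
  shows "nrt_ideal m s (\<Union>i<m. {i * s + 1..i * s + r i})"
proof -
  have ground: "i * s + r i \<le> m * s" if "i < m" for i
  proof -
    have "i * s + r i \<le> Suc i * s" using assms[OF that] by simp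
    also have "\<dots> \<le> m * s" using that by (intro mult_right_mono) auto
    finally show ?thesis .
  qed
  \<comment> \<open>\<open>nrt_le\<close> brings its own witness block \<open>i'\<close>;
    disjointness of the blocks identifies it with the index \<open>i\<close> of the segment
    containing \<open>b\<close>.\<close>
  have same_block: "i = i'"
    if "i < m" "i * s + 1 \<le> b" "b \<le> i * s + r i" "i' * s + 1 \<le> b" "b \<le> i' * s + s" for i i' b
  proof -
    have "b \<le> i * s + s" using that assms[OF \<open>i < m\<close>] by linarith
    then have "i * s < Suc i' * s" "i' * s < Suc i * s" using that by auto
    then show ?thesis by (metis mult_less_cancel2 less_Suc_eq_le le_antisym)
  qed
  show ?thesis
    unfolding nrt_ideal_def nrt_ground_def nrt_le_def nrt_block_def
  proof (intro conjI allI impI)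
    show "(\<Union>i<m. {i * s + 1..i * s + r i}) \<subseteq> {1..m * s}"
      using ground by fastforce
  next
    fix a b
    assume "b \<in> (\<Union>i<m. {i * s + 1..i * s + r i})"
      and "\<exists>i<m. a \<in> {i * s + 1..(i + 1) * s} \<and> b \<in> {i * s + 1..(i + 1) * s} \<and> a \<le> b"
    then obtain i i' where i: "i < m" "b \<in> {i * s + 1..i * s + r i}"
      and i': "a \<in> {i' * s + 1..(i' + 1) * s}" "b \<in> {i' * s + 1..(i' + 1) * s}" "a \<le> b"
      by blast
    then have "i = i'" by (intro same_block[of i b i']) auto
    then show "a \<in> (\<Union>i<m. {i * s + 1..i * s + r i})" using i i' by auto
  qed
qed

text \<open>All disagreements lie in a union of initial segments of lengths \<open>r i\<close>. That
  union is an ideal, so it contains the hull. Distances can thus be bounded block by block, by how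
  far up the words may differ.\<close>

lemma nrt_dist_le_sum:
  assumes r: "\<And>i. i < m \<Longrightarrow> r i \<le> s"
    and agree: "\<And>i j. i < m \<Longrightarrow> r i < j \<Longrightarrow> j \<le> s \<Longrightarrow> x (i * s + j) = y (i * s + j)"
  shows "nrt_dist m s x y \<le> (\<Sum>i<m. r i)"
proof -
  let ?I = "\<Union>i<m. {i * s + 1..i * s + r i}"
  have "{k \<in> nrt_ground m s. x k \<noteq> y k} \<subseteq> ?I"
  proof
    fix k assume k: "k \<in> {k \<in> nrt_ground m s. x k \<noteq> y k}"
    \<comment> \<open>Coordinates start at 1, so \<open>k\<close> is shifted before dividing; the
      offset \<open>j\<close> then runs from 1 to \<open>s\<close>, and the top of a block keeps its
      block index.\<close>
    define i where "i = (k - 1) div s"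
    define j where "j = (k - 1) mod s + 1"
    have k_bounds: "1 \<le> k" "k \<le> m * s" using k by (auto simp: nrt_ground_def)
    have s_pos: "s > 0" using k_bounds by (cases s) auto
    have k_eq: "k = i * s + j"
      unfolding i_def j_def using k_bounds by (metis add.assoc div_mult_mod_eq le_add_diff_inverse2)
    have "j \<le> s" unfolding j_def using s_pos by (simp add: Suc_leI)
    have "i < m" unfolding i_def using k_bounds
      by (intro less_mult_imp_div_less) linarith
    have "j \<le> r i"
    proof (rule ccontr)
      assume "\<not> j \<le> r i"
      then show False using agree[OF \<open>i < m\<close> _ \<open>j \<le> s\<close>] k k_eq by simp
    qed
    moreover have "1 \<le> j" by (simp add: j_def)
    ultimately have "k \<in> {i * s + 1..i * s + r i}" unfolding k_eq by simp
    then show "k \<in> ?I" using \<open>i < m\<close> by blast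
  qed
  then have "nrt_ideal_hull m s {k \<in> nrt_ground m s. x k \<noteq> y k} \<subseteq> ?I"
    unfolding nrt_ideal_hull_def using nrt_ideal_Union_initial[of m r s] r by blast
  then have "nrt_dist m s x y \<le> card ?I"
    unfolding nrt_dist_def by (intro card_mono) auto
  also have "\<dots> \<le> (\<Sum>i<m. card {i * s + 1..i * s + r i})"
    by (intro card_UN_le) auto
  finally show ?thesis by simp
qed

section \<open>Explicit coverings for three and for two blocks\<close>

lemma nrt_K_le_card: "nrt_covering q m s R C \<Longrightarrow> nrt_K q m s R \<le> card C"
  unfolding nrt_K_def by (rule Least_le) auto

lemma nrt_space_eq: "nrt_space q m s = {1..m * s} \<rightarrow>\<^sub>E {0..int q - 1}"
  by (simp add: nrt_space_def nrt_ground_def residue_ring_def)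

text \<open>Radius \<open>2 * s - 1\<close> allows one block to be ignored and another to be matched
  only at its top. The summand with \<open>(n - v)\<close> squared counts the codewords with both
  outer tops outside \<open>S\<close>; \<open>v * n\<close> comes from a repeated block with top in
  \<open>S\<close> and a free top of the middle block.\<close>

lemma nrt_K_3_le:
  assumes "v \<le> n" "n > 0" "s > 0"
  shows "nrt_K n 3 s (2 * s - 1) \<le> n ^ (s - 1) * ((n - v)\<^sup>2 + v * n)"
proof -
  define Z where "Z = {0..int n - 1}"
  define S where "S = {0..<int v}"
  have "S \<subseteq> Z" "finite S" "finite Z" using assms by (auto simp: S_def Z_def)
  have cards: "card Z = n" "card S = v" "card (Z - S) = n - v"
    using \<open>S \<subseteq> Z\<close> \<open>finite S\<close> by (auto simp: Z_def S_def card_Diff_subset)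
  have "0 \<in> Z" using assms by (simp add: Z_def)
  \<comment> \<open>Free coordinates of the first kind of codeword: the first block and the top of
    the last. \<open>B\<close> restricts exactly the two tops \<open>s\<close> and
    \<open>3 * s\<close>; \<open>g\<close> pads the rest with 0, a letter because
    \<open>n > 0\<close>.\<close>
  define J where "J = insert s (insert (3 * s) {1..<s})"
  define B where "B i = (if i < s then Z else Z - S)" for i
  define g where "g w = (\<lambda>i\<in>{1..3 * s}. if i \<le> s \<or> i = 3 * s then w i else 0)" for w :: "nat \<Rightarrow> int"
  \<comment> \<open>Free coordinates of the second kind: the block to be repeated and the top
    \<open>2 * s\<close> of the middle block, which brings the middle contribution down to
    \<open>s - 1\<close>.\<close>
  define J' where "J' = insert s (insert (2 * s) {1..<s})"
  define B' where "B' i = (if i = s then S else Z)" for i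
  define g' where "g' w = (\<lambda>i\<in>{1..3 * s}.
      if i \<le> s \<or> i = 2 * s then w i else if i > 2 * s then w (i - 2 * s) else 0)"
    for w :: "nat \<Rightarrow> int"
  let ?C = "g ` Pi\<^sub>E J B \<union> g' ` Pi\<^sub>E J' B'"
  have in_J: "i \<in> J" if "1 \<le> i" "i \<le> s \<or> i = 3 * s" for i using that by (auto simp: J_def)
  have in_J': "i \<in> J'" if "1 \<le> i" "i \<le> s \<or> i = 2 * s" for i using that by (auto simp: J'_def)
  have B_sub: "B i \<subseteq> Z" for i by (auto simp: B_def)
  have B'_sub: "B' i \<subseteq> Z" for i using \<open>S \<subseteq> Z\<close> by (auto simp: B'_def)
  have g_in: "g w \<in> {1..3 * s} \<rightarrow>\<^sub>E Z" if "w \<in> Pi\<^sub>E J B" for w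
  proof -
    have "w i \<in> Z" if "i \<in> J" for i using \<open>w \<in> Pi\<^sub>E J B\<close> that B_sub by fastforce
    then show ?thesis using \<open>0 \<in> Z\<close> in_J by (auto simp: g_def)
  qed
  have g'_in: "g' w \<in> {1..3 * s} \<rightarrow>\<^sub>E Z" if "w \<in> Pi\<^sub>E J' B'" for w
  proof -
    have "w i \<in> Z" if "i \<in> J'" for i using \<open>w \<in> Pi\<^sub>E J' B'\<close> that B'_sub by fastforce
    then have w: "w i \<in> Z" if "1 \<le> i" "i \<le> s \<or> i = 2 * s" for i using in_J' that by blast
    moreover have "w (i - 2 * s) \<in> Z" if "2 * s < i" "i \<le> 3 * s" for i
      using that by (intro w) auto
    ultimately show ?thesis using \<open>0 \<in> Z\<close> by (auto simp: g'_def)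
  qed
  \<comment> \<open>\<open>r0\<close>, \<open>r1\<close>, \<open>r2\<close> say how many bottom
    coordinates of each block may differ.\<close>
  have dist_le: "nrt_dist 3 s x c \<le> r0 + r1 + r2"
    if "r0 \<le> s" "r1 \<le> s" "r2 \<le> s"
      and "\<And>j. r0 < j \<Longrightarrow> j \<le> s \<Longrightarrow> x j = c j"
      and "\<And>j. r1 < j \<Longrightarrow> j \<le> s \<Longrightarrow> x (s + j) = c (s + j)"
      and "\<And>j. r2 < j \<Longrightarrow> j \<le> s \<Longrightarrow> x (2 * s + j) = c (2 * s + j)" for x c r0 r1 r2
  proof -
    have "nrt_dist 3 s x c \<le> (\<Sum>i<3. [r0, r1, r2] ! i)"
      by (rule nrt_dist_le_sum) (auto simp: less_Suc_eq numeral_3_eq_3 that that(6)[unfolded mult_2])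
    then show ?thesis by (simp add: numeral_3_eq_3)
  qed
  have "\<exists>c\<in>?C. nrt_dist 3 s x c \<le> 2 * s - 1" if x: "x \<in> {1..3 * s} \<rightarrow>\<^sub>E Z" for x
  proof -
    have xZ: "x i \<in> Z" if "1 \<le> i" "i \<le> 3 * s" for i using x that by auto
    consider "x s \<notin> S" "x (3 * s) \<notin> S" | "x s \<in> S" | "x (3 * s) \<in> S" by blast
    then show ?thesis
    proof cases
      case 1
      then have "restrict x J \<in> Pi\<^sub>E J B" using assms xZ by (auto simp: J_def B_def)
      moreover have "nrt_dist 3 s x (g (restrict x J)) \<le> 0 + s + (s - 1)"
        using assms in_J by (intro dist_le) (auto simp: g_def)
      ultimately show ?thesis using \<open>s > 0\<close> by (intro bexI[of _ "g (restrict x J)"]) auto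
    next
      case 2
      then have "restrict x J' \<in> Pi\<^sub>E J' B'" using assms xZ by (auto simp: J'_def B'_def)
      moreover have "nrt_dist 3 s x (g' (restrict x J')) \<le> 0 + (s - 1) + s"
        using assms in_J' by (intro dist_le) (auto simp: g'_def)
      ultimately show ?thesis using \<open>s > 0\<close> by (intro bexI[of _ "g' (restrict x J')"]) auto
    next
      case 3
      \<comment> \<open>The last block of \<open>x\<close> is moved to the first \<open>s\<close>
        coordinates, from where \<open>g'\<close> copies it back; so \<open>w s\<close> is
        \<open>x (3 * s)\<close>, which lies in \<open>S\<close>. Now the first block is the ignored
        one.\<close>
      define w where "w = (\<lambda>i\<in>J'. if i = 2 * s then x i else x (i + 2 * s))"
      have "w \<in> Pi\<^sub>E J' B'" using assms xZ 3 by (auto simp: J'_def B'_def w_def)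
      moreover have "nrt_dist 3 s x (g' w) \<le> s + (s - 1) + 0"
        using assms in_J' by (intro dist_le) (auto simp: g'_def w_def add.commute)
      ultimately show ?thesis using \<open>s > 0\<close> by (intro bexI[of _ "g' w"]) auto
    qed
  qed
  moreover have "?C \<subseteq> {1..3 * s} \<rightarrow>\<^sub>E Z" using g_in g'_in by blast
  ultimately have "nrt_covering n 3 s (2 * s - 1) ?C"
    unfolding nrt_covering_def nrt_space_eq Z_def by blast
  then have "nrt_K n 3 s (2 * s - 1) \<le> card ?C" by (rule nrt_K_le_card)
  also have "\<dots> \<le> card (g ` Pi\<^sub>E J B) + card (g' ` Pi\<^sub>E J' B')" by (rule card_Un_le)
  also have "\<dots> \<le> card (Pi\<^sub>E J B) + card (Pi\<^sub>E J' B')"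
    using \<open>finite S\<close> \<open>finite Z\<close>
    by (intro add_mono card_image_le finite_PiE) (auto simp: J_def J'_def B_def B'_def)
  also have "card (Pi\<^sub>E J B) = (n - v) * ((n - v) * n ^ (s - 1))"
    using assms by (simp add: card_PiE J_def B_def cards)
  also have "card (Pi\<^sub>E J' B') = v * (n * n ^ (s - 1))"
    using assms by (simp add: card_PiE J'_def B'_def cards)
  finally show ?thesis by (simp add: algebra_simps power2_eq_square)
qed

text \<open>With radius \<open>s\<close>, a codeword of the first kind may miss every coordinate of
  the last block below its top, at cost \<open>s - 1\<close>, and one more: the bottom of the first
  block. Since \<open>s \<ge> 2\<close>, that bottom is not a top. A repeated block leaves just the
  other block to ignore, at cost \<open>s\<close>.\<close>

lemma nrt_K_2_le:
  assumes "v \<le> n" "n > 0" "s \<ge> 2"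
  shows "nrt_K n 2 s s \<le> n ^ (s - 2) * ((n - v)\<^sup>2 + v * n)"
proof -
  define Z where "Z = {0..int n - 1}"
  define S where "S = {0..<int v}"
  have "S \<subseteq> Z" "finite S" "finite Z" using assms by (auto simp: S_def Z_def)
  have cards: "card Z = n" "card S = v" "card (Z - S) = n - v"
    using \<open>S \<subseteq> Z\<close> \<open>finite S\<close> by (auto simp: Z_def S_def card_Diff_subset)
  have "0 \<in> Z" using assms by (simp add: Z_def)
  \<comment> \<open>Starting at 2 leaves coordinate 1 unmatched, so only \<open>s - 2\<close>
    unrestricted coordinates remain besides the two tops.\<close>
  define J where "J = insert s (insert (2 * s) {2..<s})"
  define B where "B i = (if i < s then Z else Z - S)" for i
  define g where "g w = (\<lambda>i\<in>{1..2 * s}. if 2 \<le> i \<and> i \<le> s \<or> i = 2 * s then w i else 0)"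
    for w :: "nat \<Rightarrow> int"
  define J' where "J' = insert s {1..<s}"
  define B' where "B' i = (if i = s then S else Z)" for i
  define g' where "g' w = (\<lambda>i\<in>{1..2 * s}. if i \<le> s then w i else w (i - s))"
    for w :: "nat \<Rightarrow> int"
  let ?C = "g ` Pi\<^sub>E J B \<union> g' ` Pi\<^sub>E J' B'"
  have in_J: "i \<in> J" if "2 \<le> i \<and> i \<le> s \<or> i = 2 * s" for i using that by (auto simp: J_def)
  have in_J': "i \<in> J'" if "1 \<le> i" "i \<le> s" for i using that by (auto simp: J'_def)
  have B_sub: "B i \<subseteq> Z" for i by (auto simp: B_def)
  have B'_sub: "B' i \<subseteq> Z" for i using \<open>S \<subseteq> Z\<close> by (auto simp: B'_def)
  have g_in: "g w \<in> {1..2 * s} \<rightarrow>\<^sub>E Z" if "w \<in> Pi\<^sub>E J B" for w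
  proof -
    have "w i \<in> Z" if "i \<in> J" for i using \<open>w \<in> Pi\<^sub>E J B\<close> that B_sub by fastforce
    then show ?thesis using \<open>0 \<in> Z\<close> in_J by (auto simp: g_def)
  qed
  have g'_in: "g' w \<in> {1..2 * s} \<rightarrow>\<^sub>E Z" if "w \<in> Pi\<^sub>E J' B'" for w
  proof -
    have "w i \<in> Z" if "i \<in> J'" for i using \<open>w \<in> Pi\<^sub>E J' B'\<close> that B'_sub by fastforce
    then show ?thesis using in_J' by (auto simp: g'_def)
  qed
  have dist_le: "nrt_dist 2 s x c \<le> r0 + r1"
    if "r0 \<le> s" "r1 \<le> s"
      and "\<And>j. r0 < j \<Longrightarrow> j \<le> s \<Longrightarrow> x j = c j"
      and "\<And>j. r1 < j \<Longrightarrow> j \<le> s \<Longrightarrow> x (s + j) = c (s + j)" for x c r0 r1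
  proof -
    have "nrt_dist 2 s x c \<le> (\<Sum>i<2. [r0, r1] ! i)"
      by (rule nrt_dist_le_sum) (auto simp: less_Suc_eq numeral_2_eq_2 that)
    then show ?thesis by (simp add: numeral_2_eq_2)
  qed
  have "\<exists>c\<in>?C. nrt_dist 2 s x c \<le> s" if x: "x \<in> {1..2 * s} \<rightarrow>\<^sub>E Z" for x
  proof -
    have xZ: "x i \<in> Z" if "1 \<le> i" "i \<le> 2 * s" for i using x that by auto
    consider "x s \<notin> S" "x (2 * s) \<notin> S" | "x s \<in> S" | "x (2 * s) \<in> S" by blast
    then show ?thesis
    proof cases
      case 1
      then have "restrict x J \<in> Pi\<^sub>E J B" using assms xZ by (auto simp: J_def B_def)
      moreover have "nrt_dist 2 s x (g (restrict x J)) \<le> 1 + (s - 1)"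
        using assms in_J by (intro dist_le) (auto simp: g_def)
      ultimately show ?thesis using \<open>s \<ge> 2\<close> by (intro bexI[of _ "g (restrict x J)"]) auto
    next
      case 2
      then have "restrict x J' \<in> Pi\<^sub>E J' B'" using assms xZ by (auto simp: J'_def B'_def)
      moreover have "nrt_dist 2 s x (g' (restrict x J')) \<le> 0 + s"
        using assms in_J' by (intro dist_le) (auto simp: g'_def)
      ultimately show ?thesis by (intro bexI[of _ "g' (restrict x J')"]) auto
    next
      case 3
      \<comment> \<open>The repeated block is the second block of \<open>x\<close>, whose top lies
        in \<open>S\<close>.\<close>
      define w where "w = (\<lambda>i\<in>J'. x (i + s))"
      have "w \<in> Pi\<^sub>E J' B'" using assms xZ 3 by (auto simp: J'_def B'_def w_def mult_2)
      moreover have "nrt_dist 2 s x (g' w) \<le> s + 0"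
        using assms in_J' by (intro dist_le) (auto simp: g'_def w_def add.commute)
      ultimately show ?thesis by (intro bexI[of _ "g' w"]) auto
    qed
  qed
  moreover have "?C \<subseteq> {1..2 * s} \<rightarrow>\<^sub>E Z" using g_in g'_in by blast
  ultimately have "nrt_covering n 2 s s ?C"
    unfolding nrt_covering_def nrt_space_eq Z_def by blast
  then have "nrt_K n 2 s s \<le> card ?C" by (rule nrt_K_le_card)
  also have "\<dots> \<le> card (g ` Pi\<^sub>E J B) + card (g' ` Pi\<^sub>E J' B')" by (rule card_Un_le)
  also have "\<dots> \<le> card (Pi\<^sub>E J B) + card (Pi\<^sub>E J' B')"
    using \<open>finite S\<close> \<open>finite Z\<close>
    by (intro add_mono card_image_le finite_PiE) (auto simp: J_def J'_def B_def B'_def)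
  also have "card (Pi\<^sub>E J B) = (n - v) * ((n - v) * n ^ (s - 2))"
    using assms by (simp add: card_PiE J_def B_def cards)
  also have "card (Pi\<^sub>E J' B') = v * n ^ (s - 1)"
    using assms by (simp add: card_PiE J'_def B'_def cards)
  \<comment> \<open>Splits one factor \<open>n\<close> off the second count, so that both share
    \<open>n ^ (s - 2)\<close>.\<close>
  also have "s - 1 = Suc (s - 2)" using assms by simp
  finally show ?thesis by (simp add: algebra_simps power2_eq_square)
qed

section \<open>The alphabet with \<open>v * q\<close> letters\<close>

theorem corollary18:
  fixes v q s :: nat
  assumes "primepow v" and "q \<ge> 2" and "s \<ge> 3"
  shows "int (nrt_K (v * q) 3 s (2 * s - 1))
           \<le> int v ^ (s + 1) * (int q ^ (s + 1) - int q ^ (s - 1) * (int q - 1))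
         \<and> int (nrt_K (v * q) 2 s s)
           \<le> int v ^ s * (int q ^ s - int q ^ (s - 2) * (int q - 1))"
proof -
  have "v > 0" using assms(1) by (rule primepow_gt_0_nat)
  then have le: "v \<le> v * q" and pos: "v * q > 0" using assms(2) by auto
  \<comment> \<open>The natural subtraction is exact by \<open>le\<close>, so it can be factored
    over the integers.\<close>
  have diff: "int (v * q - v) = int v * (int q - 1)"
    by (simp only: of_nat_diff[OF le] of_nat_mult right_diff_distrib mult_1_right)
  obtain k where s: "s = Suc (Suc k)"
    using assms(3) that[of "s - 2"] by simp
  have "int (nrt_K (v * q) 3 s (2 * s - 1))
      \<le> int ((v * q) ^ (s - 1) * ((v * q - v)\<^sup>2 + v * (v * q)))"
    using nrt_K_3_le[OF le pos] s by (simp only: zle_int)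
  \<comment> \<open>A factor \<open>v\<close> squared comes out of the bracket, and what is left is
    \<open>(q - 1)^2 + q = q^2 - (q - 1)\<close>. The second bound uses the same identity.\<close>
  also have "\<dots> = int v ^ (s + 1) * (int q ^ (s + 1) - int q ^ (s - 1) * (int q - 1))"
    unfolding of_nat_mult of_nat_power of_nat_add diff
    by (simp add: s power_mult_distrib power2_eq_square algebra_simps)
  finally have bound3: "int (nrt_K (v * q) 3 s (2 * s - 1)) \<le> \<dots>" .
  have "int (nrt_K (v * q) 2 s s) \<le> int ((v * q) ^ (s - 2) * ((v * q - v)\<^sup>2 + v * (v * q)))"
    using nrt_K_2_le[OF le pos] s by (simp only: zle_int)
  also have "\<dots> = int v ^ s * (int q ^ s - int q ^ (s - 2) * (int q - 1))"
    unfolding of_nat_mult of_nat_power of_nat_add diff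
    by (simp add: s power_mult_distrib power2_eq_square algebra_simps)
  finally show ?thesis using bound3 by blast
qed

end
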